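(* Let $q$ be a prime power and let $\ell, m$ be positive integers with $\ell \leq m < q$. Let $(\bm{A}, \bm{B}, \bm{C}, \pi)$ be the output of $\mathsf{GenIPKP}^\star(q,\ell,m,1)$, i.e.\ $\bm{A}$ is uniformly random in $\mathbb{F}_q^{\ell \times m, \ell}$, $\bm{B}$ is uniformly random in $\mathbb{F}_q^{\star m \times 1, 1}$, $\pi$ is uniformly random in $\mathbb{S}_m$ (all independent), and $\bm{C} = \bm{A}\bm{\pi}\bm{B}$. Then \[ \mathbb{E}\big[N_{\mathsf{sol}}(\bm{A}, \bm{B}, \bm{C})\big] = 1 + \frac{(m! - 1)(q^{m - \ell} - 1)}{q^m - 1}. \]
   Context: $\mathbb{F}_q$ is the finite field with $q$ elements. $\mathbb{F}_q^{a \times b, r}$ denotes the set of $a\times b$ matrices over $\mathbb{F}_q$ of rank exactly $r$, and $\mathbb{F}_q^{\star a \times b, r}$ the subset of those whose $a$ rows are nonzero and pairwise distinct (so $\mathbb{F}_q^{\star m\times 1,1}$ is the set of column vectors of length $m$ with pairwise distinct nonzero entries). $\mathbb{S}_m$ is the symmetric group on $\{1,\dots,m\}$; for $\pi\in\mathbb{S}_m$, $\bm{\pi}$ is the $m\times m$ permutation matrix with $(i,j)$ entry $\delta_{\pi(i),j}$. $N_{\mathsf{sol}}(\bm{A},\bm{B},\bm{C})$ is the number of $\rho\in\mathbb{S}_m$ with $\bm{A}\bm{\rho}\bm{B}=\bm{C}$. *)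

theory Defs
  imports "HOL-Probability.Probability_Mass_Function" "Jordan_Normal_Form.DL_Rank"
begin

text \<open>
  The field with \<open>q\<close> elements is an arbitrary finite field type \<open>'a\<close> with \<open>CARD('a) = q\<close>; that
  \<open>q\<close> is a prime power is automatic. Matrices are indexed from 0, so \<open>\<S>\<^sub>m\<close> acts on \<open>{0..<m}\<close>.
\<close>

definition mats_rank :: "nat \<Rightarrow> nat \<Rightarrow> nat \<Rightarrow> 'a :: field mat set" where
  "mats_rank a b r = {A \<in> carrier_mat a b. vec_space.rank a A = r}"

definition mats_star_rank :: "nat \<Rightarrow> nat \<Rightarrow> nat \<Rightarrow> 'a :: field mat set" where
  "mats_star_rank a b r =
     {A \<in> mats_rank a b r. (\<forall>i<a. Matrix.row A i \<noteq> 0\<^sub>v b) \<and> inj_on (Matrix.row A) {0..<a}}"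

definition sym_group :: "nat \<Rightarrow> (nat \<Rightarrow> nat) set" where
  "sym_group m = {\<pi>. \<pi> permutes {0..<m}}"

definition perm_mat :: "nat \<Rightarrow> (nat \<Rightarrow> nat) \<Rightarrow> 'a :: field mat" where
  "perm_mat m \<pi> = Matrix.mat m m (\<lambda>(i, j). if \<pi> i = j then 1 else 0)"

definition N_sol :: "'a :: field mat \<Rightarrow> 'a mat \<Rightarrow> 'a mat \<Rightarrow> nat" where
  "N_sol A B C =
     card {\<rho> \<in> sym_group (dim_col A). A * perm_mat (dim_col A) \<rho> * B = C}"

text \<open>
  \<open>pmf_of_set\<close> is unspecified on empty sets, so this is meaningful only if the matrix sets are
  nonempty; for \<open>n = 1\<close> that holds whenever \<open>0 < l \<le> m < CARD('a)\<close>.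
\<close>

definition gen_ipkp_star ::
    "nat \<Rightarrow> nat \<Rightarrow> nat \<Rightarrow> ('a :: {field, finite} mat \<times> 'a mat \<times> 'a mat \<times> (nat \<Rightarrow> nat)) pmf" where
  "gen_ipkp_star l m n =
     bind_pmf (pmf_of_set (mats_rank l m l)) (\<lambda>A.
     bind_pmf (pmf_of_set (mats_star_rank m n n)) (\<lambda>B.
     bind_pmf (pmf_of_set (sym_group m)) (\<lambda>\<pi>.
     return_pmf (A, B, A * perm_mat m \<pi> * B, \<pi>))))"

end

theory Submission
  imports Defs
begin

text \<open>
  By linearity of expectation it suffices to find, for \<open>\<rho> \<noteq> \<pi>\<close> and fixed \<open>B\<close>, the probability that
  \<open>A v = 0\<close> for \<open>v = \<rho>B - \<pi>B\<close>, which is nonzero since the entries of \<open>B\<close> are distinct. Right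
  multiplication by invertible matrices permutes the full-rank \<open>A\<close> and acts transitively on
  nonzero vectors, so this probability does not depend on \<open>v\<close>; counting the pairs \<open>(A, v)\<close> with
  \<open>A v = 0\<close> and \<open>v \<noteq> 0\<close>, where every kernel has \<open>q\<^sup>m\<^sup>-\<^sup>l\<close> elements, gives
  \<open>(q\<^sup>m\<^sup>-\<^sup>l - 1) / (q\<^sup>m - 1)\<close>.
\<close>

unbundle no inner_syntax and no vec_syntax

section \<open>Sizes of vector and matrix spaces over a finite field\<close>

lemma card_carrier_vec:
  "card (carrier_vec n :: 'a :: finite vec set) = CARD('a) ^ n"
proof -
  have "carrier_vec n = vec_of_list ` {xs :: 'a list. set xs \<subseteq> UNIV \<and> length xs = n}"
  proof (intro equalityI subsetI)
    fix v :: "'a vec" assume "v \<in> carrier_vec n"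
    then have "v = vec_of_list (list_of_vec v)" "length (list_of_vec v) = n"
      by (auto simp: vec_list)
    then show "v \<in> vec_of_list ` {xs. set xs \<subseteq> UNIV \<and> length xs = n}" by blast
  next
    fix v :: "'a vec" assume "v \<in> vec_of_list ` {xs. set xs \<subseteq> UNIV \<and> length xs = n}"
    then show "v \<in> carrier_vec n" by (elim imageE) (simp add: carrier_dim_vec)
  qed
  moreover have "inj_on vec_of_list {xs :: 'a list. set xs \<subseteq> UNIV \<and> length xs = n}"
    by (rule inj_on_inverseI[of _ list_of_vec]) (simp add: list_vec)
  ultimately show ?thesis
    by (simp add: card_image card_lists_length_eq[of UNIV, simplified])
qed

lemma finite_carrier_vec: "finite (carrier_vec n :: 'a :: finite vec set)"
  by (rule card_ge_0_finite, unfold card_carrier_vec) (rule zero_less_power[OF zero_less_card_finite])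

lemma finite_carrier_mat: "finite (carrier_mat n m :: 'a :: finite mat set)"
proof (rule finite_subset)
  show "carrier_mat n m \<subseteq> Matrix.mat n m ` (({0..<n} \<times> {0..<m}) \<rightarrow>\<^sub>E (UNIV :: 'a set))"
  proof
    fix A :: "'a mat" assume "A \<in> carrier_mat n m"
    then show "A \<in> Matrix.mat n m ` (({0..<n} \<times> {0..<m}) \<rightarrow>\<^sub>E UNIV)"
      by (intro image_eqI[where x = "restrict (\<lambda>ij. A $$ ij) ({0..<n} \<times> {0..<m})"]) auto
  qed
qed (intro finite_imageI finite_PiE; simp)

section \<open>Full row rank as surjectivity, and the size of kernels\<close>

lemma (in vec_space) span_carrier_iff_rank:
  assumes A: "A \<in> carrier_mat n nc"
  shows "rank A = n \<longleftrightarrow> span (set (cols A)) = carrier_vec n"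
proof
  have cols: "set (cols A) \<subseteq> carrier_vec n" using A cols_dim by blast
  show "span (set (cols A)) = carrier_vec n" if r: "rank A = n"
  proof -
    \<comment> \<open>The empty set extends to a maximal independent set of columns. Its size is the
      rank, so at rank \<open>n\<close> it is already a basis of the whole space.\<close>
    have "\<exists>U. finite U \<and> maximal U (\<lambda>T. T \<subseteq> set (cols A) \<and> lin_indpt T) \<and> {} \<subseteq> U"
      by (rule maximal_exists_superset[of "set (cols A)"]) (auto simp: lin_dep_def)
    then obtain U where U: "finite U" "maximal U (\<lambda>T. T \<subseteq> set (cols A) \<and> lin_indpt T)"
      by blast
    then have U': "U \<subseteq> set (cols A)" "lin_indpt U" by (auto simp: maximal_def)
    have "card U = n" using rank_card_indpt[OF A U(2)] r by simp
    then have "basis U"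
      using U U' cols by (intro dim_li_is_basis) (auto simp: dim_is_n)
    then have "carrier_vec n \<subseteq> span U" by (simp add: basis_def)
    also have "\<dots> \<subseteq> span (set (cols A))" using U' span_is_monotone by blast
    finally show ?thesis using span_closed[OF cols] by auto
  qed
  show "rank A = n" if "span (set (cols A)) = carrier_vec n"
    using that dim_is_n by (simp add: rank_def module_vec_def)
qed

text \<open>The column space is the image of \<open>A\<close>. Surjectivity is the form of the rank
  condition used from here on: it passes directly to products and to fibre counts.\<close>

lemma mats_rank_full_iff:
  "A \<in> mats_rank l m l \<longleftrightarrow> A \<in> carrier_mat l m \<and> (\<lambda>v. A *\<^sub>v v) ` carrier_vec m = carrier_vec l"
proof (cases "A \<in> carrier_mat l m")
  case True
  interpret vec_space "TYPE('a)" l .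
  have "rank A = l \<longleftrightarrow> col_space A = carrier_vec l"
    using span_carrier_iff_rank[OF True] by (simp add: col_space_def)
  also have "col_space A = (\<lambda>v. A *\<^sub>v v) ` carrier_vec m"
    using True by (auto simp: col_space_eq[OF True])
  finally show ?thesis using True by (simp add: mats_rank_def)
qed (simp add: mats_rank_def)

text \<open>Each fibre over a vector of length \<open>l\<close> is a translate of the kernel by some
  preimage, so the \<open>q^m\<close> vectors split into \<open>q^l\<close> classes of equal
  size.\<close>

lemma card_kernel_surjective:
  fixes A :: "'a :: {field, finite} mat"
  assumes A: "A \<in> carrier_mat l m"
    and surj: "(\<lambda>v. A *\<^sub>v v) ` carrier_vec m = carrier_vec l"
    and "l \<le> m"
  shows "card {v \<in> carrier_vec m. A *\<^sub>v v = 0\<^sub>v l} = CARD('a) ^ (m - l)"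
proof -
  define K where "K = {v \<in> carrier_vec m. A *\<^sub>v v = 0\<^sub>v l}"
  have fib: "card {v \<in> carrier_vec m. A *\<^sub>v v = w} = card K" if w: "w \<in> carrier_vec l" for w
  proof -
    obtain u where u: "u \<in> carrier_vec m" "A *\<^sub>v u = w"
      using surj w by (metis imageE)
    have "bij_betw (\<lambda>v. v + u) K {v \<in> carrier_vec m. A *\<^sub>v v = w}"
    proof (rule bij_betw_byWitness[where f' = "\<lambda>v. v - u"])
      show "(\<lambda>v. v + u) ` K \<subseteq> {v \<in> carrier_vec m. A *\<^sub>v v = w}"
        using u A w by (auto simp: K_def mult_add_distrib_mat_vec[OF A])
      show "(\<lambda>v. v - u) ` {v \<in> carrier_vec m. A *\<^sub>v v = w} \<subseteq> K"
        using u A w by (auto simp: K_def mult_minus_distrib_mat_vec[OF A])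
    qed (use u in \<open>auto simp: K_def\<close>)
    then show ?thesis by (simp add: bij_betw_same_card)
  qed
  have "CARD('a) ^ m = card (carrier_vec m :: 'a vec set)" by (simp add: card_carrier_vec)
  also have "\<dots> = (\<Sum>w\<in>carrier_vec l. card {v \<in> carrier_vec m. A *\<^sub>v v = w})"
  proof -
    have "(\<Sum>w\<in>carrier_vec l. card {v \<in> carrier_vec m. A *\<^sub>v v = w})
        = card (\<Union>w\<in>carrier_vec l. {v \<in> carrier_vec m. A *\<^sub>v v = w})"
      by (rule card_UN_disjoint[symmetric]) (auto simp: finite_carrier_vec)
    also have "(\<Union>w\<in>carrier_vec l. {v \<in> carrier_vec m. A *\<^sub>v v = w}) = carrier_vec m"
      using surj by auto
    finally show ?thesis by simp
  qed
  also have "\<dots> = CARD('a) ^ l * card K" by (simp add: fib card_carrier_vec)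
  finally have "CARD('a) ^ l * card K = CARD('a) ^ l * CARD('a) ^ (m - l)"
    using \<open>l \<le> m\<close> by (simp flip: power_add)
  then show ?thesis by (simp add: K_def)
qed

section \<open>Transitivity of invertible matrices on nonzero vectors\<close>

text \<open>Supplies the functional for the rank-one update below, where both
  \<open>f \<bullet> v\<close> and \<open>f \<bullet> w\<close> occur as denominators. A unit vector
  works unless each of the chosen nonzero entries faces a zero of the other vector; then the sum of
  the two unit vectors works, over every field.\<close>

lemma scalar_prod_nonzero_both:
  fixes v w :: "'a :: field vec"
  assumes "v \<in> carrier_vec m" "w \<in> carrier_vec m" "v \<noteq> 0\<^sub>v m" "w \<noteq> 0\<^sub>v m"
  obtains f where "f \<in> carrier_vec m" "f \<bullet> v \<noteq> 0" "f \<bullet> w \<noteq> 0"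
proof -
  obtain i where i: "i < m" "v $ i \<noteq> 0" using assms by (metis carrier_vecD eq_vecI index_zero_vec)
  obtain j where j: "j < m" "w $ j \<noteq> 0" using assms by (metis carrier_vecD eq_vecI index_zero_vec)
  consider "w $ i \<noteq> 0" | "v $ j \<noteq> 0" | "w $ i = 0" "v $ j = 0" by blast
  then show ?thesis
  proof cases
    case 1 then show ?thesis using i assms that[of "unit_vec m i"] by simp
  next
    case 2 then show ?thesis using j assms that[of "unit_vec m j"] by simp
  next
    case 3 then show ?thesis using i j assms that[of "unit_vec m i + unit_vec m j"]
      by (simp add: add_scalar_prod_distrib[of _ m])
  qed
qed

text \<open>Surjectivity stands in for invertibility of \<open>P\<close>: it gives both cancellation
  of \<open>P\<close> on the right and preservation of full row rank.\<close>

lemma transitive_on_nonzero_vecs: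
  fixes v w :: "'a :: field vec"
  assumes v: "v \<in> carrier_vec m" "v \<noteq> 0\<^sub>v m" and w: "w \<in> carrier_vec m" "w \<noteq> 0\<^sub>v m"
  obtains P where "P \<in> carrier_mat m m" "P *\<^sub>v v = w" "(\<lambda>u. P *\<^sub>v u) ` carrier_vec m = carrier_vec m"
proof -
  obtain f where f: "f \<in> carrier_vec m" "f \<bullet> v \<noteq> 0" "f \<bullet> w \<noteq> 0"
    using scalar_prod_nonzero_both v w by blast
  txt \<open>The rank-one update \<open>I + (w - v) f\<^sup>T / (f \<bullet> v)\<close> sends \<open>v\<close> to \<open>w\<close>; exchanging \<open>v\<close> and \<open>w\<close> inverts it.\<close>
  define P where "P = Matrix.mat m m
    (\<lambda>(i, j). (if i = j then 1 else 0) + (w $ i - v $ i) / (f \<bullet> v) * f $ j)"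
  have P: "P \<in> carrier_mat m m" by (simp add: P_def)
  have Pu: "P *\<^sub>v u = u + ((f \<bullet> u) / (f \<bullet> v)) \<cdot>\<^sub>v (w - v)" if "u \<in> carrier_vec m" for u
  proof (rule eq_vecI)
    fix i assume "i < dim_vec (u + ((f \<bullet> u) / (f \<bullet> v)) \<cdot>\<^sub>v (w - v))"
    then have i: "i < m" using v by simp
    have "(P *\<^sub>v u) $ i = (\<Sum>j = 0..<m.
        ((if i = j then 1 else 0) + (w $ i - v $ i) / (f \<bullet> v) * f $ j) * u $ j)"
      using i that by (simp add: P_def scalar_prod_def)
    also have "\<dots> = (\<Sum>j = 0..<m. if i = j then u $ j else 0)
        + (w $ i - v $ i) / (f \<bullet> v) * (\<Sum>j = 0..<m. f $ j * u $ j)"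
      unfolding sum_distrib_left sum.distrib[symmetric]
      by (rule sum.cong) (auto simp: algebra_simps)
    also have "\<dots> = u $ i + (w $ i - v $ i) / (f \<bullet> v) * (f \<bullet> u)"
      using i that by (simp add: scalar_prod_def)
    finally show "(P *\<^sub>v u) $ i = (u + ((f \<bullet> u) / (f \<bullet> v)) \<cdot>\<^sub>v (w - v)) $ i"
      using i v w that by simp
  qed (use v w P that in auto)
  have Pv: "P *\<^sub>v v = w" using v w f by (auto simp: Pu)
  have "z \<in> (\<lambda>u. P *\<^sub>v u) ` carrier_vec m" if z: "z \<in> carrier_vec m" for z
  proof
    let ?u = "z + ((f \<bullet> z) / (f \<bullet> w)) \<cdot>\<^sub>v (v - w)"
    show u: "?u \<in> carrier_vec m" using z v w by simp
    \<comment> \<open>The ratio \<open>(f \<bullet> ?u) / (f \<bullet> v)\<close> turns out to be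
      the coefficient already used in \<open>?u\<close>, so what \<open>P\<close> adds cancels the
      correction made to \<open>z\<close>.\<close>
    have "f \<bullet> ?u = f \<bullet> z + (f \<bullet> z) / (f \<bullet> w) * (f \<bullet> v - f \<bullet> w)"
      using f v w z by (simp add: scalar_prod_add_distrib[of _ m] scalar_prod_minus_distrib[of _ m])
    also have "\<dots> = (f \<bullet> z) / (f \<bullet> w) * (f \<bullet> v)" using f by (simp add: field_simps)
    finally have "(f \<bullet> ?u) / (f \<bullet> v) = (f \<bullet> z) / (f \<bullet> w)" using f by simp
    then have "P *\<^sub>v ?u = ?u + ((f \<bullet> z) / (f \<bullet> w)) \<cdot>\<^sub>v (w - v)"
      using Pu[OF u] by simp
    also have "\<dots> = z"
      using v w z by (intro eq_vecI) (auto simp: algebra_simps diff_divide_distrib)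
    finally show "z = P *\<^sub>v ?u" by simp
  qed
  then have "(\<lambda>u. P *\<^sub>v u) ` carrier_vec m = carrier_vec m" using P by auto
  then show ?thesis using that P Pv by blast
qed

section \<open>Counting full-rank matrices that annihilate a given vector\<close>

lemma eq_mat_of_mult_vec_eq:
  fixes A B :: "'a :: field mat"
  assumes A: "A \<in> carrier_mat l m" and B: "B \<in> carrier_mat l m"
    and eq: "\<And>v. v \<in> carrier_vec m \<Longrightarrow> A *\<^sub>v v = B *\<^sub>v v"
  shows "A = B"
proof (rule eq_matI)
  fix i j assume "i < dim_row B" "j < dim_col B"
  then have ij: "i < l" "j < m" using B by auto
  have "(A *\<^sub>v unit_vec m j) $ i = (B *\<^sub>v unit_vec m j) $ i" using eq by simp
  then show "A $$ (i, j) = B $$ (i, j)"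
    using ij A B by simp
qed (use A B in auto)

lemma finite_mats_rank: "finite (mats_rank a b r :: 'a :: {field, finite} mat set)"
  using finite_carrier_mat by (rule rev_finite_subset) (auto simp: mats_rank_def)

text \<open>If \<open>P\<close> sends \<open>v\<close> to \<open>w\<close>, then
  \<open>A * P\<close> sends \<open>v\<close> to \<open>A w\<close>, so right multiplication by
  \<open>P\<close> injects the annihilators of \<open>w\<close> into those of \<open>v\<close>. One
  inequality is enough, since \<open>v\<close> and \<open>w\<close> can be exchanged.\<close>

lemma card_annihilating_le:
  fixes v w :: "'a :: {field, finite} vec"
  assumes v: "v \<in> carrier_vec m" "v \<noteq> 0\<^sub>v m" and w: "w \<in> carrier_vec m" "w \<noteq> 0\<^sub>v m"
  shows "card {A \<in> mats_rank l m l. A *\<^sub>v w = 0\<^sub>v l} \<le> card {A \<in> mats_rank l m l. A *\<^sub>v v = 0\<^sub>v l}"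
proof -
  obtain P where P: "P \<in> carrier_mat m m" "P *\<^sub>v v = w"
    and surj: "(\<lambda>u. P *\<^sub>v u) ` carrier_vec m = carrier_vec m"
    using transitive_on_nonzero_vecs[OF v w] by blast
  have assoc: "(A * P) *\<^sub>v u = A *\<^sub>v (P *\<^sub>v u)"
    if "A \<in> carrier_mat l m" "u \<in> carrier_vec m" for A u
    using that P by simp
  show ?thesis
  proof (rule card_inj_on_le[of "\<lambda>A. A * P"])
    show "inj_on (\<lambda>A. A * P) {A \<in> mats_rank l m l. A *\<^sub>v w = 0\<^sub>v l}"
    proof (rule inj_onI)
      fix A B assume "A \<in> {A \<in> mats_rank l m l. A *\<^sub>v w = 0\<^sub>v l}"
        "B \<in> {A \<in> mats_rank l m l. A *\<^sub>v w = 0\<^sub>v l}" and eq: "A * P = B * P"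
      then have A: "A \<in> carrier_mat l m" and B: "B \<in> carrier_mat l m"
        by (auto simp: mats_rank_def)
      show "A = B"
      \<comment> \<open>\<open>A\<close> and \<open>B\<close> agree on the image of
        \<open>P\<close>, which is everything.\<close>
      proof (rule eq_mat_of_mult_vec_eq[OF A B])
        fix u :: "'a vec" assume "u \<in> carrier_vec m"
        then obtain u' where "u' \<in> carrier_vec m" "u = P *\<^sub>v u'" using surj by (metis imageE)
        then show "A *\<^sub>v u = B *\<^sub>v u" using assoc[OF A] assoc[OF B] eq by metis
      qed
    qed
    show "(\<lambda>A. A * P) ` {A \<in> mats_rank l m l. A *\<^sub>v w = 0\<^sub>v l}
        \<subseteq> {A \<in> mats_rank l m l. A *\<^sub>v v = 0\<^sub>v l}"
    proof (clarify, intro conjI)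
      fix A assume A': "A \<in> mats_rank l m l" "A *\<^sub>v w = 0\<^sub>v l"
      then have A: "A \<in> carrier_mat l m"
        and surjA: "(\<lambda>u. A *\<^sub>v u) ` carrier_vec m = carrier_vec l"
        by (simp_all add: mats_rank_full_iff)
      have "(\<lambda>u. (A * P) *\<^sub>v u) ` carrier_vec m = (\<lambda>u. A *\<^sub>v u) ` (\<lambda>u. P *\<^sub>v u) ` carrier_vec m"
        by (auto simp: image_image assoc[OF A] intro!: image_cong)
      then show "A * P \<in> mats_rank l m l"
        using A P by (simp add: mats_rank_full_iff surj surjA)
      show "A * P *\<^sub>v v = 0\<^sub>v l" using assoc[OF A v(1)] P A' by simp
    qed
  qed (simp add: finite_mats_rank)
qed

text \<open>Double counting of the pairs \<open>(A, u)\<close> with \<open>A u = 0\<close>. Each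
  \<open>A\<close> contributes its kernel; \<open>u = 0\<close> contributes every matrix, and all
  other \<open>u\<close> contribute as much as \<open>v\<close>. The division by
  \<open>q^m - 1\<close> is left to \<open>sum_N_sol\<close>.\<close>

lemma card_annihilating:
  fixes v :: "'a :: {field, finite} vec"
  assumes v: "v \<in> carrier_vec m" "v \<noteq> 0\<^sub>v m" and "l \<le> m"
  shows "real (card {A \<in> mats_rank l m l. A *\<^sub>v v = 0\<^sub>v l}) * (real CARD('a) ^ m - 1)
    = real (card (mats_rank l m l :: 'a mat set)) * (real CARD('a) ^ (m - l) - 1)"
proof -
  define M where "M = (mats_rank l m l :: 'a mat set)"
  define S where "S u = {A \<in> M. A *\<^sub>v u = 0\<^sub>v l}" for u
  have finM: "finite M" by (simp add: M_def finite_mats_rank)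
  have S: "card (S u) = card (S v)" if "u \<in> carrier_vec m - {0\<^sub>v m}" for u
    unfolding S_def M_def using that v by (intro antisym card_annihilating_le) auto
  have S0: "S (0\<^sub>v m) = M" by (auto simp: S_def M_def mats_rank_def)
  have "card M * CARD('a) ^ (m - l) = (\<Sum>A\<in>M. card {u \<in> carrier_vec m. A *\<^sub>v u = 0\<^sub>v l})"
    using \<open>l \<le> m\<close> by (simp add: M_def mats_rank_full_iff card_kernel_surjective)
  also have "\<dots> = (\<Sum>u\<in>carrier_vec m. card (S u))"
    unfolding S_def by (rule sum_multicount_gen) (auto simp: finM finite_carrier_vec)
  also have "\<dots> = card (S (0\<^sub>v m)) + (\<Sum>u\<in>carrier_vec m - {0\<^sub>v m}. card (S u))"
    by (rule sum.remove) (auto simp: finite_carrier_vec)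
  also have "\<dots> = card M + (CARD('a) ^ m - 1) * card (S v)"
    by (simp add: S S0 card_Diff_singleton card_carrier_vec)
  finally have "real (card M * CARD('a) ^ (m - l)) = real (card M + (CARD('a) ^ m - 1) * card (S v))"
    by (rule arg_cong)
  \<comment> \<open>Truncated subtraction agrees with the real one because
    \<open>1 \<le> q^m\<close>.\<close>
  then have "real (card M) * real CARD('a) ^ (m - l) = real (card M) + (real CARD('a) ^ m - 1) * real (card (S v))"
    using of_nat_diff[of 1 "CARD('a) ^ m", where 'a=real] one_le_power[of "CARD('a)" m] by simp
  then show ?thesis
    by (simp add: S_def M_def algebra_simps)
qed

section \<open>Nonemptiness of the sample spaces\<close>

text \<open>The witness is an identity block followed by zero columns; padding a vector with zeros
  gives its preimage.\<close>

lemma mats_rank_full_nonempty: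
  assumes "l \<le> m"
  shows "(mats_rank l m l :: 'a :: field mat set) \<noteq> {}"
proof -
  define A :: "'a mat" where "A = Matrix.mat l m (\<lambda>(i, j). if i = j then 1 else 0)"
  have A: "A \<in> carrier_mat l m" by (simp add: A_def)
  have "w \<in> (\<lambda>v. A *\<^sub>v v) ` carrier_vec m" if w: "w \<in> carrier_vec l" for w
  proof
    show "w = A *\<^sub>v Matrix.vec m (\<lambda>i. if i < l then w $ i else 0)"
      using w assms
      by (intro eq_vecI) (auto simp: A_def scalar_prod_def if_distrib[of "\<lambda>x. x * _"] cong: if_cong)
  qed simp
  then have "(\<lambda>v. A *\<^sub>v v) ` carrier_vec m = carrier_vec l" using A by auto
  then show ?thesis using A mats_rank_full_iff by blast
qed

text \<open>Supplies the rank condition that \<open>mats_star_rank\<close> imposes besides the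
  condition on the rows.\<close>

lemma rank_single_col:
  fixes B :: "'a :: field mat"
  assumes B: "B \<in> carrier_mat m 1" and i: "i < m" "B $$ (i, 0) \<noteq> 0"
  shows "vec_space.rank m B = 1"
proof -
  interpret vec_space "TYPE('a)" m .
  have d: "distinct (cols B)" using B by (simp add: cols_def)
  have "lin_indpt (set (cols B))"
  proof
    assume "lin_dep (set (cols B))"
    then obtain v where v: "v \<in> carrier_vec 1" "v \<noteq> 0\<^sub>v 1" "B *\<^sub>v v = 0\<^sub>v m"
      using lin_depE[OF B _ d] by blast
    have "v $ 0 \<noteq> 0"
    proof
      assume "v $ 0 = 0"
      then have "v = 0\<^sub>v 1" using v(1) by (intro eq_vecI) auto
      then show False using v(2) by simp
    qed
    moreover have "(B *\<^sub>v v) $ i = B $$ (i, 0) * v $ 0"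
      using B i v(1) by (simp add: scalar_prod_def)
    ultimately show False using v(3) i by (metis index_zero_vec(1) mult_eq_0_iff)
  qed
  then show ?thesis using lin_indpt_full_rank[OF B d] by simp
qed

text \<open>The \<open>q - 1\<close> nonzero field elements leave room for \<open>m\<close> distinct
  entries when \<open>m < q\<close>. With \<open>0 < m\<close> the column has a nonzero entry, hence
  rank 1.\<close>

lemma mats_star_rank_1_nonempty:
  assumes "0 < m" "m < CARD('a)"
  shows "(mats_star_rank m 1 1 :: 'a :: {field, finite} mat set) \<noteq> {}"
proof -
  have "card {0..<m} \<le> card (UNIV - {0 :: 'a})"
    using assms by (simp add: card_Diff_singleton)
  then obtain g :: "nat \<Rightarrow> 'a" where g: "inj_on g {0..<m}" "g ` {0..<m} \<subseteq> UNIV - {0}"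
    by (metis card_le_inj finite finite_atLeastLessThan)
  define B where "B = Matrix.mat m 1 (\<lambda>(i, j). g i)"
  have B: "B \<in> carrier_mat m 1" by (simp add: B_def)
  have g0: "g i \<noteq> 0" if "i < m" for i using g(2) that by fastforce
  have row: "Matrix.row B i $ 0 = g i" if "i < m" for i using that by (simp add: B_def)
  have "vec_space.rank m B = 1"
    using rank_single_col[OF B, of 0] g0[of 0] assms by (simp add: B_def)
  moreover have "Matrix.row B i \<noteq> 0\<^sub>v 1" if "i < m" for i
    using row[OF that] g0[OF that] by auto
  moreover have "inj_on (Matrix.row B) {0..<m}"
    using row g(1) unfolding inj_on_def by (metis atLeastLessThan_iff)
  ultimately have "B \<in> mats_star_rank m 1 1"
    using B by (simp add: mats_star_rank_def mats_rank_def)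
  then show ?thesis by blast
qed

section \<open>Solutions as permutations whose difference vector lies in the kernel\<close>

lemma mats_star_rank_1_inj:
  assumes "B \<in> mats_star_rank m 1 1"
  shows "B \<in> carrier_mat m 1" "inj_on (\<lambda>i. B $$ (i, 0)) {0..<m}"
proof -
  show B: "B \<in> carrier_mat m 1" using assms by (simp add: mats_star_rank_def mats_rank_def)
  have row: "Matrix.row B i = Matrix.row B j" if "i < m" "j < m" "B $$ (i, 0) = B $$ (j, 0)" for i j
    using that B by (intro eq_vecI) auto
  have "inj_on (Matrix.row B) {0..<m}" using assms by (simp add: mats_star_rank_def)
  then show "inj_on (\<lambda>i. B $$ (i, 0)) {0..<m}"
    by (intro inj_onI) (metis row atLeastLessThan_iff inj_onD)
qed

text \<open>Row \<open>i\<close> of the permutation matrix has its 1 in column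
  \<open>\<rho> i\<close>, so entries are pulled back along \<open>\<rho>\<close> itself and not its
  inverse.\<close>

lemma perm_mat_mult_col:
  assumes "B \<in> carrier_mat m 1" "\<rho> \<in> sym_group m"
  shows "perm_mat m \<rho> *\<^sub>v Matrix.col B 0 = Matrix.vec m (\<lambda>i. B $$ (\<rho> i, 0))"
proof (rule eq_vecI)
  fix i assume "i < dim_vec (Matrix.vec m (\<lambda>i. B $$ (\<rho> i, 0)))"
  then have "i < m" "\<rho> i < m" using assms(2) permutes_in_image[of \<rho> "{0..<m}" i]
    by (auto simp: sym_group_def)
  then show "(perm_mat m \<rho> *\<^sub>v Matrix.col B 0) $ i = Matrix.vec m (\<lambda>i. B $$ (\<rho> i, 0)) $ i"
    using assms by (simp add: perm_mat_def scalar_prod_def if_distrib[of "\<lambda>x. x * _"] cong: if_cong)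
qed (simp add: perm_mat_def)

lemma eq_iff_minus_eq_0_vec:
  fixes x y :: "'a :: group_add vec"
  assumes "x \<in> carrier_vec n" "y \<in> carrier_vec n"
  shows "x = y \<longleftrightarrow> x - y = 0\<^sub>v n"
proof
  assume "x - y = 0\<^sub>v n"
  then have "(x - y) $ i = 0" if "i < n" for i using that by simp
  then show "x = y" using assms by (intro eq_vecI) auto
qed (use assms in simp)

text \<open>One-column matrices are compared through column 0, and linearity of \<open>A\<close>
  moves both sides into one vector. Being a solution thus becomes the annihilation condition counted
  by \<open>card_annihilating\<close>.\<close>

lemma solution_iff:
  fixes A :: "'a :: field mat"
  assumes A: "A \<in> carrier_mat l m" and B: "B \<in> carrier_mat m 1"
    and \<rho>: "\<rho> \<in> sym_group m" and \<pi>: "\<pi> \<in> sym_group m"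
  shows "A * perm_mat m \<rho> * B = A * perm_mat m \<pi> * B \<longleftrightarrow>
    A *\<^sub>v Matrix.vec m (\<lambda>i. B $$ (\<rho> i, 0) - B $$ (\<pi> i, 0)) = 0\<^sub>v l"
proof -
  let ?v = "\<lambda>\<rho>. Matrix.vec m (\<lambda>i. B $$ (\<rho> i, 0))"
  have P: "perm_mat m \<sigma> \<in> carrier_mat m m" for \<sigma> :: "nat \<Rightarrow> nat" by (simp add: perm_mat_def)
  have col: "Matrix.col (A * perm_mat m \<sigma> * B) 0 = A *\<^sub>v ?v \<sigma>" if "\<sigma> \<in> sym_group m" for \<sigma>
  proof -
    have "Matrix.col (A * perm_mat m \<sigma> * B) 0 = (A * perm_mat m \<sigma>) *\<^sub>v Matrix.col B 0"
      using B by (intro col_mult2[of _ l m _ 1] mult_carrier_mat[OF A P]) auto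
    also have "\<dots> = A *\<^sub>v (perm_mat m \<sigma> *\<^sub>v Matrix.col B 0)"
      using B by (intro assoc_mult_mat_vec[OF A P]) auto
    finally show ?thesis using perm_mat_mult_col[OF B that] by simp
  qed
  have eq1: "X = Y \<longleftrightarrow> Matrix.col X 0 = Matrix.col Y 0"
    if "X \<in> carrier_mat l 1" "Y \<in> carrier_mat l 1" for X Y :: "'a mat"
    using that by (auto intro: mat_col_eqI)
  have "A * perm_mat m \<rho> * B = A * perm_mat m \<pi> * B \<longleftrightarrow> A *\<^sub>v ?v \<rho> = A *\<^sub>v ?v \<pi>"
    using B by (subst eq1) (simp_all add: col[OF \<rho>] col[OF \<pi>] mult_carrier_mat[OF mult_carrier_mat[OF A P] B[unfolded One_nat_def]])
  also have "\<dots> \<longleftrightarrow> A *\<^sub>v ?v \<rho> - A *\<^sub>v ?v \<pi> = 0\<^sub>v l"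
    using A by (intro eq_iff_minus_eq_0_vec[of _ l]) auto
  also have "A *\<^sub>v ?v \<rho> - A *\<^sub>v ?v \<pi> = A *\<^sub>v (?v \<rho> - ?v \<pi>)"
    by (rule mult_minus_distrib_mat_vec[OF A, symmetric]) auto
  also have "?v \<rho> - ?v \<pi> = Matrix.vec m (\<lambda>i. B $$ (\<rho> i, 0) - B $$ (\<pi> i, 0))"
    by auto
  finally show ?thesis .
qed

section \<open>The expected number of solutions\<close>

lemma card_sym_group: "finite (sym_group m)" "card (sym_group m) = fact m"
  by (simp_all add: sym_group_def finite_permutations card_permutations[OF card_atLeastLessThan])

text \<open>Averaging over \<open>A\<close> alone suffices, with \<open>B\<close> and
  \<open>\<pi>\<close> fixed. After exchanging the sums over \<open>A\<close> and
  \<open>\<rho>\<close>, the term \<open>\<rho> = \<pi>\<close> counts every matrix, and each of the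
  other \<open>m! - 1\<close> terms counts the same fraction \<open>p\<close> of them.\<close>

lemma sum_N_sol:
  fixes B :: "'a :: {field, finite} mat"
  assumes B: "B \<in> mats_star_rank m 1 1" and \<pi>: "\<pi> \<in> sym_group m" and "0 < m" "m < CARD('a)" "l \<le> m"
  defines "M \<equiv> (mats_rank l m l :: 'a mat set)"
  shows "(\<Sum>A\<in>M. real (N_sol A B (A * perm_mat m \<pi> * B)))
    = real (card M) * (1 + (fact m - 1) * (real CARD('a) ^ (m - l) - 1) / (real CARD('a) ^ m - 1))"
proof -
  define d where "d \<rho> = Matrix.vec m (\<lambda>i. B $$ (\<rho> i, 0) - B $$ (\<pi> i, 0))" for \<rho> :: "nat \<Rightarrow> nat"
  define p where "p = (real CARD('a) ^ (m - l) - 1) / (real CARD('a) ^ m - 1)"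
  define S where "S = (\<lambda>\<rho>. {A \<in> M. A *\<^sub>v d \<rho> = 0\<^sub>v l})"
  note B' = mats_star_rank_1_inj[OF B]
  have M: "A \<in> carrier_mat l m" if "A \<in> M" for A using that by (simp add: M_def mats_rank_def)
  have "(1 :: real) < real CARD('a) ^ m"
    using \<open>0 < m\<close> \<open>m < CARD('a)\<close> by (intro one_less_power) auto
  then have q: "real CARD('a) ^ m - 1 \<noteq> 0" by simp
  have S_ne: "real (card (S \<rho>)) = real (card M) * p" if \<rho>: "\<rho> \<in> sym_group m - {\<pi>}" for \<rho>
  proof -
    obtain i where i: "\<rho> i \<noteq> \<pi> i" using \<rho> by auto
    have i': "i < m" "\<rho> i < m" "\<pi> i < m"
    proof -
      \<comment> \<open>Both permutations fix every index outside \<open>{0..<m}\<close>, so they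
        can differ only inside.\<close>
      show "i < m" using i \<rho> \<pi> by (metis DiffD1 atLeastLessThan_iff mem_Collect_eq permutes_def sym_group_def zero_le)
      then show "\<rho> i < m" "\<pi> i < m" using \<rho> \<pi> permutes_in_image[of _ "{0..<m}" i]
        by (auto simp: sym_group_def)
    qed
    \<comment> \<open>Distinctness of the entries of \<open>B\<close> makes the difference vector
      nonzero.\<close>
    have "B $$ (\<rho> i, 0) \<noteq> B $$ (\<pi> i, 0)" using B'(2) i i' by (auto dest: inj_onD)
    then have "d \<rho> $ i \<noteq> 0" using i' by (simp add: d_def)
    then have "d \<rho> \<noteq> 0\<^sub>v m" using i' by auto
    then have "real (card (S \<rho>)) * (real CARD('a) ^ m - 1) = real (card M) * (real CARD('a) ^ (m - l) - 1)"
      unfolding S_def M_def using \<open>l \<le> m\<close> by (intro card_annihilating) (auto simp: d_def)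
    then show ?thesis using q by (simp add: p_def field_simps)
  qed
  have "d \<pi> = 0\<^sub>v m" by (auto simp: d_def)
  then have S_eq: "S \<pi> = M" by (auto simp: S_def M_def mats_rank_def)
  have "(\<Sum>A\<in>M. N_sol A B (A * perm_mat m \<pi> * B))
      = (\<Sum>A\<in>M. card {\<rho> \<in> sym_group m. A *\<^sub>v d \<rho> = 0\<^sub>v l})"
  proof (rule sum.cong)
    fix A assume "A \<in> M"
    note A = M[OF this]
    have "{\<rho> \<in> sym_group (dim_col A). A * perm_mat (dim_col A) \<rho> * B = A * perm_mat m \<pi> * B}
        = {\<rho> \<in> sym_group m. A *\<^sub>v d \<rho> = 0\<^sub>v l}"
      using A solution_iff[OF A B'(1) _ \<pi>] by (auto simp: d_def)
    then show "N_sol A B (A * perm_mat m \<pi> * B) = card {\<rho> \<in> sym_group m. A *\<^sub>v d \<rho> = 0\<^sub>v l}"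
      by (simp add: N_sol_def)
  qed simp
  also have "\<dots> = (\<Sum>\<rho>\<in>sym_group m. card (S \<rho>))"
    unfolding S_def by (rule sum_multicount_gen) (auto simp: card_sym_group M_def finite_mats_rank)
  finally have "(\<Sum>A\<in>M. real (N_sol A B (A * perm_mat m \<pi> * B))) = (\<Sum>\<rho>\<in>sym_group m. real (card (S \<rho>)))"
    by (metis of_nat_sum)
  also have "\<dots> = real (card (S \<pi>)) + (\<Sum>\<rho>\<in>sym_group m - {\<pi>}. real (card (S \<rho>)))"
    using \<pi> by (intro sum.remove) (auto simp: card_sym_group)
  also have "\<dots> = real (card M) + (fact m - 1) * (real (card M) * p)"
    using \<pi> by (simp add: S_ne S_eq card_Diff_singleton card_sym_group of_nat_diff)
  finally show ?thesis by (simp add: p_def algebra_simps)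
qed

theorem theorem2:
  fixes q l m :: nat
  assumes "CARD('a :: {field, finite}) = q"
    and "0 < l" and "0 < m" and "l \<le> m" and "m < q"
  shows "measure_pmf.expectation
           (gen_ipkp_star l m 1 :: ('a mat \<times> 'a mat \<times> 'a mat \<times> (nat \<Rightarrow> nat)) pmf)
           (\<lambda>(A, B, C, \<pi>). real (N_sol A B C))
         = 1 + (fact m - 1) * (real q ^ (m - l) - 1) / (real q ^ m - 1)"
proof -
  define M where "M = (mats_rank l m l :: 'a mat set)"
  define N where "N = (mats_star_rank m 1 1 :: 'a mat set)"
  define G where "G = sym_group m"
  define e where "e = 1 + (fact m - 1) * (real q ^ (m - l) - 1) / (real q ^ m - 1)"
  have M: "finite M" "M \<noteq> {}"
    unfolding M_def by (rule finite_mats_rank, rule mats_rank_full_nonempty[OF \<open>l \<le> m\<close>])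
  have N: "finite N" "N \<noteq> {}"
  proof -
    show "finite N"
      using finite_mats_rank[of m 1 1] by (rule rev_finite_subset) (auto simp: N_def mats_star_rank_def)
    show "N \<noteq> {}"
      unfolding N_def using assms by (intro mats_star_rank_1_nonempty) auto
  qed
  have G: "finite G" "G \<noteq> {}"
    unfolding G_def using card_sym_group[of m] by (simp, metis card.empty fact_nonzero)
  \<comment> \<open>Three independent uniform draws give a nested average over finite nonempty
    sets.\<close>
  have "measure_pmf.expectation (gen_ipkp_star l m 1 :: ('a mat \<times> 'a mat \<times> 'a mat \<times> (nat \<Rightarrow> nat)) pmf)
           (\<lambda>(A, B, C, \<pi>). real (N_sol A B C))
      = (\<Sum>A\<in>M. (\<Sum>B\<in>N. (\<Sum>\<pi>\<in>G. real (N_sol A B (A * perm_mat m \<pi> * B))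
          /\<^sub>R card G) /\<^sub>R card N) /\<^sub>R card M)"
    unfolding gen_ipkp_star_def M_def[symmetric] N_def[symmetric] G_def[symmetric]
    using M N G by (simp add: pmf_expectation_bind_pmf_of_set del: real_scaleR_def)
  also have "\<dots> = (\<Sum>A\<in>M. \<Sum>B\<in>N. \<Sum>\<pi>\<in>G. real (N_sol A B (A * perm_mat m \<pi> * B)) / (card M * card N * card G))"
    by (simp add: sum_distrib_left divide_inverse mult_ac)
  \<comment> \<open>The sum over \<open>A\<close> is moved innermost, because only the average over
    \<open>A\<close> has a value independent of the other two draws.\<close>
  also have "\<dots> = (\<Sum>B\<in>N. \<Sum>A\<in>M. \<Sum>\<pi>\<in>G. real (N_sol A B (A * perm_mat m \<pi> * B)) / (card M * card N * card G))"
    by (rule sum.swap)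
  also have "\<dots> = (\<Sum>B\<in>N. \<Sum>\<pi>\<in>G. \<Sum>A\<in>M. real (N_sol A B (A * perm_mat m \<pi> * B)) / (card M * card N * card G))"
    by (rule sum.cong[OF refl], rule sum.swap)
  also have "\<dots> = (\<Sum>B\<in>N. \<Sum>\<pi>\<in>G. card M * e / (card M * card N * card G))"
  proof (intro sum.cong refl)
    fix B \<pi> assume "B \<in> N" "\<pi> \<in> G"
    then have "(\<Sum>A\<in>M. real (N_sol A B (A * perm_mat m \<pi> * B))) = card M * e"
      unfolding M_def N_def G_def e_def using assms sum_N_sol[of B m \<pi> l] by simp
    then show "(\<Sum>A\<in>M. real (N_sol A B (A * perm_mat m \<pi> * B)) / (card M * card N * card G))
        = card M * e / (card M * card N * card G)"
      by (simp only: sum_divide_distrib[symmetric])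
  qed
  \<comment> \<open>The average of a constant; nonemptiness lets the three cardinalities
    cancel.\<close>
  also have "\<dots> = e" using M N G by simp
  finally show ?thesis by (simp add: e_def)
qed

end
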